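(* Let $k\ge 0$ be an integer. For any connected graph $G$, \[\gamma_P(G)+k \le \ddot{\gamma}_P^k(G) \le (k+1)\,\gamma_P(G).\]
   Context: Graphs are finite and simple, with at least one vertex. For a vertex $v$, $N[v]$ denotes its closed neighborhood. The power domination process on a graph $G$ with initial set $S\subseteq V(G)$: (1) set $B=\bigcup_{v\in S}N[v]$; (2) while there is $v\in B$ with exactly one neighbor $u\notin B$, add $u$ to $B$. A set $S$ is a power dominating set of $G$ if $B=V(G)$ when the process terminates. $\gamma_P(G)$ is the minimum cardinality of a power dominating set of $G$. A multiset of vertices is called a power dominating set if its underlying set is one. For an integer $k\ge 0$, a $k$-robust power dominating set of $G$ is a finite multiset $S$ of elements of $V(G)$ with $|S|\ge k$ (counted with multiplicity) such that for every submultiset $F$ of $S$ with $|F|=k$, the multiset difference $S\setminus F$ is a power dominating set of $G$. $\ddot{\gamma}_P^k(G)$ denotes the minimum cardinality (with multiplicity) of a $k$-robust power dominating set of $G$. *)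

theory Defs
  imports "Graph_Theory.Digraph_Component" "HOL-Library.Multiset"
begin

text \<open>
  Finite simple graphs are the loop-free symmetric digraphs without multiple arcs of the locale
  \<^locale>\<open>graph\<close>; its null graph is excluded by \<^const>\<open>Digraph_Component.connected\<close>,
  which demands a vertex.
\<close>

definition nbrs :: "('a, 'b) pre_digraph \<Rightarrow> 'a \<Rightarrow> 'a set" where
  "nbrs G v = {u. v \<rightarrow>\<^bsub>G\<^esub> u}"

definition closed_nbrs :: "('a, 'b) pre_digraph \<Rightarrow> 'a \<Rightarrow> 'a set" where
  "closed_nbrs G v = insert v (nbrs G v)"

definition pd_step :: "('a, 'b) pre_digraph \<Rightarrow> 'a set \<Rightarrow> 'a set \<Rightarrow> bool" where
  "pd_step G B B' \<longleftrightarrow> (\<exists>v\<in>B. \<exists>u. nbrs G v - B = {u} \<and> B' = insert u B)"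

definition pd_outcome :: "('a, 'b) pre_digraph \<Rightarrow> 'a set \<Rightarrow> 'a set \<Rightarrow> bool" where
  "pd_outcome G S B \<longleftrightarrow> (pd_step G)\<^sup>*\<^sup>* (\<Union>v\<in>S. closed_nbrs G v) B \<and> (\<nexists>B'. pd_step G B B')"

text \<open>
  The process may choose among several forcing vertices. By \<open>pd_outcome_unique\<close> and
  \<open>pd_outcome_exists\<close> below, the outcome does not depend on these choices.
\<close>

definition power_dominating_set :: "('a, 'b) pre_digraph \<Rightarrow> 'a set \<Rightarrow> bool" where
  "power_dominating_set G S \<longleftrightarrow> S \<subseteq> verts G \<and> pd_outcome G S (verts G)"

definition power_domination_number :: "('a, 'b) pre_digraph \<Rightarrow> nat" where
  "power_domination_number G = (LEAST n. \<exists>S. power_dominating_set G S \<and> card S = n)"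

definition robust_power_dominating_set ::
    "nat \<Rightarrow> ('a, 'b) pre_digraph \<Rightarrow> 'a multiset \<Rightarrow> bool" where
  "robust_power_dominating_set k G S \<longleftrightarrow>
     set_mset S \<subseteq> verts G \<and> k \<le> size S \<and>
     (\<forall>F. F \<subseteq># S \<and> size F = k \<longrightarrow> power_dominating_set G (set_mset (S - F)))"

definition robust_power_domination_number :: "nat \<Rightarrow> ('a, 'b) pre_digraph \<Rightarrow> nat" where
  "robust_power_domination_number k G =
     (LEAST n. \<exists>S. robust_power_dominating_set k G S \<and> size S = n)"

lemma pd_steps_subset:
  assumes "(pd_step G)\<^sup>*\<^sup>* A C" "A \<subseteq> B" "\<nexists>B'. pd_step G B B'"
  shows "C \<subseteq> B"
  using assms(1)
proof (induction rule: rtranclp_induct)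
  case base
  show ?case using assms(2) .
next
  case (step C D)
  then obtain v u where vu: "v \<in> C" "nbrs G v - C = {u}" "D = insert u C"
    by (auto simp: pd_step_def)
  have "u \<in> B"
  proof (rule ccontr)
    assume "u \<notin> B"
    then have "nbrs G v - B = {u}" using vu step.IH by blast
    moreover have "v \<in> B" using vu(1) step.IH by blast
    ultimately have "pd_step G B (insert u B)" unfolding pd_step_def by blast
    then show False using assms(3) by blast
  qed
  then show ?case using vu step.IH by simp
qed

lemma pd_steps_mono: "(pd_step G)\<^sup>*\<^sup>* A C \<Longrightarrow> A \<subseteq> C"
  by (induction rule: rtranclp_induct) (auto simp: pd_step_def)

lemma pd_outcome_unique:
  assumes "pd_outcome G S B" "pd_outcome G S C"
  shows "B = C"
  using assms unfolding pd_outcome_def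
  by (metis pd_steps_mono pd_steps_subset subset_antisym)

lemma pd_outcome_exists:
  assumes "graph G" "S \<subseteq> verts G"
  shows "\<exists>B. pd_outcome G S B"
proof -
  interpret graph G by fact
  have nb: "nbrs G v \<subseteq> verts G" for v
    by (auto simp: nbrs_def dest: adj_in_verts)
  have run: "\<exists>B. (pd_step G)\<^sup>*\<^sup>* A B \<and> (\<nexists>B'. pd_step G B B')" if "A \<subseteq> verts G" for A
    using that
  proof (induction "card (verts G - A)" arbitrary: A rule: less_induct)
    case less
    show ?case
    proof (cases "\<exists>A'. pd_step G A A'")
      case False
      then show ?thesis by blast
    next
      case True
      then obtain v u where vu: "nbrs G v - A = {u}" "pd_step G A (insert u A)"
        by (auto simp: pd_step_def)
      have u: "u \<in> verts G - A" using vu(1) nb by blast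
      have "card (verts G - insert u A) < card (verts G - A)"
        using u by (intro psubset_card_mono) auto
      moreover have "insert u A \<subseteq> verts G" using u less.prems by simp
      ultimately show ?thesis
        using less.hyps vu(2) by (meson converse_rtranclp_into_rtranclp)
    qed
  qed
  have "(\<Union>v\<in>S. closed_nbrs G v) \<subseteq> verts G"
    using assms(2) nb by (auto simp: closed_nbrs_def)
  then show ?thesis using run by (auto simp: pd_outcome_def)
qed

end

theory Submission
  imports Defs
begin

text \<open>Both bounds come from counting multiplicities. Lower bound
  (\<open>robust_power_dominating_set_size_ge\<close>): removing any k elements from a robust
  multiset M leaves a power dominating set with at most |M| - k distinct vertices. Upper bound
  (\<open>robust_power_dominating_set_repeat_mset\<close>): take k + 1 copies of each vertex of a
  minimum power dominating set S. Removing k elements cannot exhaust the copies of any vertex, so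
  the underlying set is still S.\<close>

lemma power_dominating_set_verts:
  assumes "graph G"
  shows "power_dominating_set G (verts G)"
proof -
  interpret graph G by fact
  have "nbrs G v \<subseteq> verts G" for v
    by (auto simp: nbrs_def dest: adj_in_verts)
  then have "(\<Union>v\<in>verts G. closed_nbrs G v) = verts G" and "\<nexists>B'. pd_step G (verts G) B'"
    by (auto simp: closed_nbrs_def pd_step_def)
  then show ?thesis
    by (simp add: power_dominating_set_def pd_outcome_def)
qed

text \<open>From the empty set no vertex ever forces, so the process stops at once with outcome
  \<open>{}\<close>; since outcomes are unique, this is not all of a nonempty
  \<open>verts G\<close>.\<close>

lemma power_dominating_set_nonempty:
  assumes "power_dominating_set G S" "verts G \<noteq> {}"
  shows "S \<noteq> {}"
proof
  assume "S = {}"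
  moreover have "pd_outcome G {} {}"
    by (simp add: pd_outcome_def pd_step_def)
  ultimately show False
    using assms pd_outcome_unique unfolding power_dominating_set_def by metis
qed

lemma power_domination_number_le:
  "power_dominating_set G S \<Longrightarrow> power_domination_number G \<le> card S"
  unfolding power_domination_number_def by (rule Least_le) blast

text \<open>The \<open>LEAST\<close> is attained because \<open>verts G\<close> itself is power
  dominating.\<close>

lemma ex_minimum_power_dominating_set:
  assumes "graph G"
  obtains S where "power_dominating_set G S" "card S = power_domination_number G"
proof -
  have "\<exists>n S. power_dominating_set G S \<and> card S = n"
    using power_dominating_set_verts[OF assms] by blast
  from LeastI_ex[OF this] show ?thesis
    using that unfolding power_domination_number_def by blast
qed

lemma robust_power_domination_number_le:
  "robust_power_dominating_set k G M \<Longrightarrow> robust_power_domination_number k G \<le> size M"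
  unfolding robust_power_domination_number_def by (rule Least_le) blast

text \<open>The given \<open>M\<close> only witnesses that the set of sizes under the
  \<open>LEAST\<close> is nonempty; the repeated multiset will serve as this witness.\<close>

lemma ex_minimum_robust_power_dominating_set:
  assumes "robust_power_dominating_set k G M"
  obtains N where "robust_power_dominating_set k G N" "size N = robust_power_domination_number k G"
proof -
  have "\<exists>n N. robust_power_dominating_set k G N \<and> size N = n"
    using assms by blast
  from LeastI_ex[OF this] show ?thesis
    using that unfolding robust_power_domination_number_def by blast
qed

lemma card_set_mset_le_size: "card (set_mset M) \<le> size M"
  by (induction M) (auto simp: card_insert_if)

lemma robust_power_dominating_set_size_ge:
  assumes "robust_power_dominating_set k G M"
  shows "power_domination_number G + k \<le> size M"
proof -
  have "k \<le> size M"
    using assms by (simp add: robust_power_dominating_set_def)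
  \<comment> \<open>Listing \<open>M\<close> makes a submultiset of size exactly k available: the
    first k entries.\<close>
  obtain xs where xs: "mset xs = M"
    using ex_mset by blast
  define F where "F = mset (take k xs)"
  have F: "F \<subseteq># M"
    unfolding F_def xs[symmetric] by (metis append_take_drop_id mset_append mset_subset_eq_add_left)
  have k: "size F = k"
    using \<open>k \<le> size M\<close> xs by (auto simp: F_def)
  have "power_domination_number G \<le> card (set_mset (M - F))"
    using assms F k by (auto simp: robust_power_dominating_set_def intro: power_domination_number_le)
  also have "\<dots> \<le> size M - k"
    using card_set_mset_le_size[of "M - F"] F k by (simp add: size_Diff_submset)
  finally show ?thesis
    using \<open>k \<le> size M\<close> by simp
qed

lemma robust_power_dominating_set_repeat_mset:
  assumes "power_dominating_set G S" "finite S" "S \<noteq> {}"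
  shows "robust_power_dominating_set k G (repeat_mset (k + 1) (mset_set S))"
  unfolding robust_power_dominating_set_def
proof (intro conjI allI impI)
  let ?M = "repeat_mset (k + 1) (mset_set S)"
  have set_M: "set_mset ?M = S"
    unfolding set_mset_def count_repeat_mset using assms(2) by (auto simp: count_mset_set')
  then show "set_mset ?M \<subseteq> verts G"
    using assms(1) by (simp add: power_dominating_set_def)
  \<comment> \<open>The size condition is where \<open>S \<noteq> {}\<close> enters: copies of the
    empty set would have size 0, too small for positive k.\<close>
  have "1 \<le> card S"
    using assms by (simp add: Suc_le_eq card_gt_0_iff)
  then have "k * 1 \<le> (k + 1) * card S"
    by (intro mult_le_mono) auto
  then show "k \<le> size ?M"
    by simp
  fix F assume F: "F \<subseteq># ?M \<and> size F = k"
  \<comment> \<open>Each vertex of \<open>S\<close> occurs k + 1 times in \<open>?M\<close>, so at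
    least one copy survives the removal of \<open>F\<close>.\<close>
  have "count F x \<le> k" for x
    using F count_le_size by metis
  then have "x \<in># ?M - F" if "x \<in> S" for x
    using that assms by (simp add: in_diff_count less_Suc_eq_le)
  moreover have "set_mset (?M - F) \<subseteq> S"
    using set_M in_diffD[of _ ?M F] by blast
  ultimately have "set_mset (?M - F) = S"
    by blast
  then show "power_dominating_set G (set_mset (?M - F))"
    using assms by simp
qed

theorem proposition3p3:
  fixes G :: "('a, 'b) pre_digraph" and k :: nat
  assumes "graph G" and "Digraph_Component.connected G"
  shows "power_domination_number G + k \<le> robust_power_domination_number k G \<and>
         robust_power_domination_number k G \<le> (k + 1) * power_domination_number G"
proof -
  interpret graph G by fact
  have ne: "verts G \<noteq> {}"
    using assms(2) by (auto simp: Digraph_Component.connected_def strongly_connected_def)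
  obtain S where S: "power_dominating_set G S" "card S = power_domination_number G"
    using ex_minimum_power_dominating_set[OF assms(1)] .
  have "finite S"
    using S(1) finite_subset[OF _ finite_verts] by (simp add: power_dominating_set_def)
  then have M: "robust_power_dominating_set k G (repeat_mset (k + 1) (mset_set S))"
    using S(1) power_dominating_set_nonempty[OF S(1) ne]
    by (intro robust_power_dominating_set_repeat_mset)
  \<comment> \<open>The lower bound is applied to a minimum robust multiset \<open>N\<close>; the
    upper bound is the size of the explicit one in \<open>M\<close>.\<close>
  obtain N where "robust_power_dominating_set k G N" "size N = robust_power_domination_number k G"
    using ex_minimum_robust_power_dominating_set[OF M] .
  then show ?thesis
    using robust_power_dominating_set_size_ge robust_power_domination_number_le[OF M] S(2)
    by fastforce
qed

end
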